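(* Let $1\le m\le n$. Then, as an identity in the variables $x,y$, $$\sum_{\pi\in \mathrm{PF}(m,n)} x^{\mathrm{slev}(\pi)}y^{\mathrm{lel}(\pi)}=(n-m+1)xy\Big[(m-1)\big((n-m+1)x+y+m-1\big)^{m-2}+\big(xy+(n-m)x+1\big)\big(xy+(n-m)x+m\big)^{m-2}\Big].$$
   Context: $\mathrm{PF}(m,n)$ is the set of parking functions with $m$ cars and $n$ spots: there are $n$ spots $1,\dots,n$ in order on a one-way street; cars $1,\dots,m$ enter one by one, car $i$ drives to its preferred spot $\pi_i\in\{1,\dots,n\}$ and parks there if it is free, otherwise it parks in the first available later spot; $\pi=(\pi_1,\dots,\pi_m)$ is a parking function if all cars succeed in parking. Equivalently, $\#\{k:\pi_k\le i\}\ge m-n+i$ for $i=n-m+1,\dots,n$. $\mathrm{lel}(\pi)=\#\{i:\pi_i=\pi_1\}$ (leading elements) and $\mathrm{slev}(\pi)=\#\{i:\pi_i\in\{1,2,\dots,n-m+1\}\}$ (size of level set). For $m=1$ (exponent $-1$) the right-hand side is read as a rational function. *)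

theory Defs
  imports "HOL-Computational_Algebra.Polynomial" "HOL-Computational_Algebra.Fraction_Field"
begin

(* parks n S ps: when the spots in S are already taken, all cars with preference list ps
   (entering from left to right) succeed in parking on a one-way street with spots 1..n. *)
fun parks :: "nat \<Rightarrow> nat set \<Rightarrow> nat list \<Rightarrow> bool" where
  "parks n S [] = True"
| "parks n S (p # ps) =
     (let free = {p..n} - S in free \<noteq> {} \<and> parks n (insert (Min free) S) ps)"

definition PF :: "nat \<Rightarrow> nat \<Rightarrow> nat list set" where
  "PF m n = {ps. length ps = m \<and> set ps \<subseteq> {1..n} \<and> parks n {} ps}"

(* Lists are indexed from 0, so the preference of the first car is ps ! 0. *)
definition lel :: "nat list \<Rightarrow> nat" where
  "lel ps = card {i. i < length ps \<and> ps ! i = ps ! 0}"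

(* The number of cars and of spots are explicit parameters, since the level set
   {1..n-m+1} depends on both; only used for m \<le> n, where n - m is not truncated. *)
definition slev :: "nat \<Rightarrow> nat \<Rightarrow> nat list \<Rightarrow> nat" where
  "slev m n ps = card {i. i < length ps \<and> ps ! i \<in> {1..n - m + 1}}"

(* The indeterminates x and y in the field of fractions of Z[x][y]; rational functions are
   needed because the exponent m - 2 is negative for m = 1. *)
definition X :: "int poly poly fract" where
  "X = Fract [:[:0, 1:]:] 1"

definition Y :: "int poly poly fract" where
  "Y = Fract [:0, 1:] 1"

end

theory Submission
  imports Defs
begin

text \<open>
  Whether all cars can park depends only on counts: it means that for every \<open>i\<close> at most
  \<open>n - i\<close> cars prefer a spot beyond \<open>i\<close> (\<open>parks_iff_counts\<close>). Suppose that the first \<open>k\<close> spots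
  satisfy \<open>m + k \<le> n + 1\<close>. Then the conditions with \<open>i < k\<close> hold for any \<open>m\<close> cars, so the cars
  that prefer the first \<open>k\<close> spots may be inserted anywhere and without constraint, and what is
  left is the same condition for the other cars on the last \<open>n - k\<close> spots
  (\<open>fits_filter_iff\<close>). Choosing the positions of the \<open>c\<close> cars inside the block produces a binomial
  sum (\<open>sum_words_Un\<close>).

  This single decomposition is used twice. With \<open>k = 1\<close> it gives recursions whose solutions are,
  for \<open>r\<close> cars on \<open>d\<close> spots, the classical number \<open>(d + 1 - r) (d + 1)^(r - 1)\<close> of parking
  functions (\<open>fit_count_closed\<close>) and, for one leading car followed by \<open>r\<close> more cars on \<open>d\<close> spots,
  the generating function \<open>(d - r) (y + d)^r\<close> of the number of later cars that share the
  preference of the first one (\<open>led_sum_closed\<close>). With \<open>k = n - m + 1\<close>, the largest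
  block that can be removed, it removes exactly the level set. If the leading car prefers one of
  the \<open>k\<close> spots of the level set, each further car inside the level set has total weight
  \<open>x y + (k - 1) x\<close> and the remaining ones are counted by \<open>fit_count\<close>; this yields the second
  summand of the formula. Otherwise each car inside the level set has weight \<open>k x\<close> and the remaining
  ones are counted by \<open>led_sum\<close>; this yields the first summand (\<open>level_led_sum_closed\<close>). All
  the sums that occur are instances of the binomial theorem and of its derivative.
\<close>

section \<open>Parking as a counting condition\<close>

text \<open>
  For positive preferences the case \<open>i = 0\<close> bounds the number of cars, and the truncated difference makes the cases
  \<open>i \<ge> N\<close> forbid preferences beyond spot \<open>N\<close>.
\<close>
definition fits :: "nat \<Rightarrow> nat list \<Rightarrow> bool" where
  "fits N ps \<longleftrightarrow> (\<forall>i. length (filter (\<lambda>p. i < p) ps) \<le> N - i)"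

text \<open>
  Treating an occupied spot like a car that prefers it makes the criterion invariant under parking
  one car. If the car prefers \<open>p\<close> and parks in \<open>q\<close>, only the bounds with \<open>p \<le> i < q\<close> become
  stricter, and these follow from the old bound at \<open>p - 1\<close> because all the spots from \<open>p\<close>
  to \<open>q - 1\<close> are occupied.
\<close>
lemma parks_iff_counts:
  assumes "set ps \<subseteq> {1..n}"
  shows "parks n S ps \<longleftrightarrow>
    (\<forall>i. length (filter (\<lambda>p. i < p) ps) + card (S \<inter> {i<..n}) \<le> n - i)"
  using assms
proof (induction ps arbitrary: S)
  case Nil
  have "card (S \<inter> {i<..n}) \<le> n - i" for i
    using card_mono[of "{i<..n}" "S \<inter> {i<..n}"] by simp
  then show ?case by simp
next
  case (Cons p ps)
  have p: "1 \<le> p" "p \<le> n" and ps: "set ps \<subseteq> {1..n}" using Cons.prems by auto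
  let ?free = "{p..n} - S"
  let ?cond = "\<lambda>qs T. \<forall>i. length (filter (\<lambda>p. i < p) qs) + card (T \<inter> {i<..n}) \<le> n - i"
  show ?case
  proof (cases "?free = {}")
    case True
    \<comment> \<open>The spots from \<open>p\<close> on are all occupied, so the car itself violates the bound at \<open>p - 1\<close>.\<close>
    moreover have "{p - 1<..n} = {p..n}" using p by auto
    ultimately have "S \<inter> {p - 1<..n} = {p - 1<..n}" by auto
    then have "card (S \<inter> {p - 1<..n}) = n - (p - 1)" by simp
    then have "\<not> length (filter (\<lambda>q. p - 1 < q) (p # ps)) + card (S \<inter> {p - 1<..n}) \<le> n - (p - 1)"
      using p by simp
    then have "\<not> ?cond (p # ps) S" by blast
    then show ?thesis using True by simp
  next
    case False
    define q where "q = Min ?free"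
    have fin: "finite ?free" by simp
    have q: "p \<le> q" "q \<le> n" "q \<notin> S" using Min_in[OF fin False] by (auto simp: q_def)
    have taken: "{p..<q} \<subseteq> S"
    proof
      fix a assume a: "a \<in> {p..<q}"
      show "a \<in> S"
      proof (rule ccontr)
        assume "a \<notin> S"
        then have "a \<in> ?free" using a q by auto
        from Min_le[OF fin this] show False using a by (simp add: q_def)
      qed
    qed
    have ins: "card (insert q S \<inter> {i<..n}) = card (S \<inter> {i<..n}) + (if i < q then 1 else 0)" for i
    proof (cases "i < q")
      case True
      then have "insert q S \<inter> {i<..n} = insert q (S \<inter> {i<..n})" using q by auto
      then show ?thesis using q True by simp
    next
      case False
      then have "insert q S \<inter> {i<..n} = S \<inter> {i<..n}" by auto
      then show ?thesis using False by simp
    qed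
    have "?cond ps (insert q S) \<longleftrightarrow> ?cond (p # ps) S"
    proof
      assume c: "?cond ps (insert q S)"
      show "?cond (p # ps) S"
      proof
        fix i
        from c have "length (filter (\<lambda>p. i < p) ps) + card (insert q S \<inter> {i<..n}) \<le> n - i" by blast
        then show "length (filter (\<lambda>p. i < p) (p # ps)) + card (S \<inter> {i<..n}) \<le> n - i"
          using q unfolding ins by (auto split: if_splits)
      qed
    next
      assume c: "?cond (p # ps) S"
      show "?cond ps (insert q S)"
      proof
        fix i
        show "length (filter (\<lambda>p. i < p) ps) + card (insert q S \<inter> {i<..n}) \<le> n - i"
        proof (cases "p \<le> i \<and> i < q")
          case False
          moreover from c have "length (filter (\<lambda>p. i < p) (p # ps)) + card (S \<inter> {i<..n}) \<le> n - i"
            by blast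
          ultimately show ?thesis using q unfolding ins by (auto split: if_splits)
        next
          case True
          from c have "length (filter (\<lambda>q. p - 1 < q) (p # ps)) + card (S \<inter> {p - 1<..n}) \<le> n - (p - 1)"
            by blast
          then have 1: "1 + length (filter (\<lambda>q. p - 1 < q) ps) + card (S \<inter> {p - 1<..n}) \<le> n - p + 1"
            using p by simp
          have "S \<inter> {p - 1<..n} = {p..i} \<union> (S \<inter> {i<..n})"
            using taken True q p by (auto simp: subset_iff)
          then have 2: "card (S \<inter> {p - 1<..n}) = (i + 1 - p) + card (S \<inter> {i<..n})"
            by (simp add: card_Un_disjoint disjoint_iff)
          have 3: "length (filter (\<lambda>p. i < p) ps) \<le> length (filter (\<lambda>q. p - 1 < q) ps)"
            using True by (induction ps) auto
          show ?thesis using 1 2 3 True q unfolding ins by auto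
        qed
      qed
    qed
    then show ?thesis using False Cons.IH[OF ps, of "insert q S"] by (simp add: Let_def q_def)
  qed
qed

text \<open>
  Writing the spots as the half-open interval \<open>{0<..n}\<close> lets blocks of initial spots be split off
  by moving the lower end, without renumbering.
\<close>
lemma PF_eq_fits:
  "PF m n = {ps. set ps \<subseteq> {0<..n} \<and> length ps = m \<and> fits n ps}"
proof -
  have "{0<..n} = {1..n}" by auto
  then show ?thesis
    using parks_iff_counts[of _ n "{}"] by (auto simp: PF_def fits_def)
qed

text \<open>
  For \<open>i < b\<close> the bound \<open>N - i\<close> is at least the number of all cars, so cars that prefer a
  spot up to \<open>b\<close> are irrelevant.
\<close>
lemma fits_filter_iff:
  assumes "length ps + b \<le> N + 1"
  shows "fits N ps \<longleftrightarrow> fits N (filter (\<lambda>p. b < p) ps)"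
proof -
  have le: "length (filter (\<lambda>p. i < p) (filter (\<lambda>p. b < p) ps)) \<le> length (filter (\<lambda>p. i < p) ps)" for i
    by (induction ps) auto
  have high: "length (filter (\<lambda>p. i < p) (filter (\<lambda>p. b < p) ps)) = length (filter (\<lambda>p. i < p) ps)"
    if "b \<le> i" for i
    using that by (induction ps) auto
  have low: "length (filter (\<lambda>p. i < p) ps) \<le> N - i" if "i < b" for i
    using that assms length_filter_le[of "\<lambda>p. i < p" ps] by linarith
  show ?thesis
    unfolding fits_def using le high low by (metis le_trans not_le)
qed

lemma not_fits_if_too_long:
  assumes "set ps \<subseteq> {b<..N}" "b \<le> N" "N < length ps + b"
  shows "\<not> fits N ps"
proof -
  have "filter (\<lambda>p. b < p) ps = ps" using assms(1) by (intro filter_True) auto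
  then have "\<not> length (filter (\<lambda>p. b < p) ps) \<le> N - b" using assms by simp
  then show ?thesis unfolding fits_def by blast
qed


section \<open>Sums over words\<close>

definition words :: "nat \<Rightarrow> 'a set \<Rightarrow> 'a list set" where
  "words r A = {xs. set xs \<subseteq> A \<and> length xs = r}"

lemma finite_words [simp]: "finite A \<Longrightarrow> finite (words r A)"
  unfolding words_def by (rule finite_lists_length_eq)

lemma words_0 [simp]: "words 0 A = {[]}"
  by (auto simp: words_def)

lemma sum_words_Suc:
  "(\<Sum>xs\<in>words (Suc r) A. f xs) = (\<Sum>v\<in>A. \<Sum>xs\<in>words r A. f (v # xs))"
proof -
  have "(\<Sum>v\<in>A. \<Sum>xs\<in>words r A. f (v # xs)) = (\<Sum>(v, xs)\<in>A \<times> words r A. f (v # xs))"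
    by (rule sum.cartesian_product)
  also have "\<dots> = (\<Sum>xs\<in>words (Suc r) A. f xs)"
    by (rule sum.reindex_bij_witness[where i = "\<lambda>xs. (hd xs, tl xs)" and j = "\<lambda>(v, xs). v # xs"])
       (auto simp: words_def length_Suc_conv)
  finally show ?thesis by simp
qed

text \<open>
  Pascal's rule, in the form in which it matches the recursion of a sum over words that splits off
  the first letter.
\<close>
lemma sum_choose_Suc:
  fixes a :: "'a::comm_ring_1"
  shows "(\<Sum>c\<le>Suc r. of_nat (Suc r choose c) * a ^ c * h (Suc r - c)) =
    a * (\<Sum>c\<le>r. of_nat (r choose c) * a ^ c * h (r - c)) +
    (\<Sum>c\<le>r. of_nat (r choose c) * a ^ c * h (Suc (r - c)))"
proof -
  have "(\<Sum>c\<le>r. of_nat (r choose c) * a ^ c * h (Suc (r - c))) =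
        (\<Sum>c\<le>Suc r. of_nat (r choose c) * a ^ c * h (Suc r - c))"
    by (simp add: Suc_diff_le binomial_eq_0)
  also have "\<dots> = h (Suc r) + (\<Sum>c\<le>r. of_nat (r choose Suc c) * a ^ Suc c * h (r - c))"
    by (subst sum.atMost_Suc_shift) simp
  finally show ?thesis
    by (subst sum.atMost_Suc_shift)
       (simp add: sum_distrib_left sum.distrib[symmetric] algebra_simps)
qed

text \<open>
  A word over \<open>A \<union> B\<close> is a shuffle of a word over \<open>A\<close> and a word over \<open>B\<close>, and there are
  \<open>r choose c\<close> ways to place the \<open>c\<close> letters from \<open>A\<close>. The summand is multiplicative on the
  letters from \<open>A\<close>, so these contribute the power \<open>sum w A ^ c\<close>; on the letters from \<open>B\<close> it is
  arbitrary, which leaves room for the parking condition.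
\<close>
lemma sum_words_Un:
  fixes w :: "'a \<Rightarrow> 'b::comm_ring_1"
  assumes "finite A" "finite B" "A \<inter> B = {}"
  shows "(\<Sum>xs\<in>words r (A \<union> B).
           prod_list (map w (filter (\<lambda>x. x \<in> A) xs)) * f (filter (\<lambda>x. x \<in> B) xs)) =
    (\<Sum>c\<le>r. of_nat (r choose c) * sum w A ^ c * (\<Sum>xs\<in>words (r - c) B. f xs))"
proof (induction r arbitrary: f)
  case 0
  show ?case by simp
next
  case (Suc r)
  let ?S = "\<lambda>f. \<Sum>xs\<in>words r (A \<union> B).
           prod_list (map w (filter (\<lambda>x. x \<in> A) xs)) * f (filter (\<lambda>x. x \<in> B) xs)"
  have "(\<Sum>xs\<in>words (Suc r) (A \<union> B).
           prod_list (map w (filter (\<lambda>x. x \<in> A) xs)) * f (filter (\<lambda>x. x \<in> B) xs)) =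
        (\<Sum>v\<in>A. w v * ?S f) + (\<Sum>v\<in>B. ?S (\<lambda>xs. f (v # xs)))"
    unfolding sum_words_Suc sum.union_disjoint[OF assms]
    using assms(3)
    by (intro arg_cong2[of _ _ _ _ "(+)"] sum.cong refl)
       (auto simp: sum_distrib_left mult.assoc disjoint_iff intro!: sum.cong)
  also have "(\<Sum>v\<in>B. ?S (\<lambda>xs. f (v # xs))) =
      (\<Sum>c\<le>r. of_nat (r choose c) * sum w A ^ c * (\<Sum>xs\<in>words (Suc (r - c)) B. f xs))"
    unfolding sum_words_Suc sum_distrib_left
    by (subst sum.swap) (intro sum.cong refl Suc.IH[of "\<lambda>xs. f (_ # xs)", unfolded sum_distrib_left])
  also have "(\<Sum>v\<in>A. w v * ?S f) =
      sum w A * (\<Sum>c\<le>r. of_nat (r choose c) * sum w A ^ c * (\<Sum>xs\<in>words (r - c) B. f xs))"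
    unfolding Suc.IH by (rule sum_distrib_right[symmetric])
  finally show ?case
    unfolding sum_choose_Suc[of r "sum w A" "\<lambda>j. \<Sum>xs\<in>words j B. f xs"] .
qed


section \<open>Removing the first block of spots\<close>

definition fit_count :: "nat \<Rightarrow> nat \<Rightarrow> nat \<Rightarrow> 'a::comm_ring_1" where
  "fit_count N b r = (\<Sum>ps\<in>words r {b<..N}. of_bool (fits N ps))"

text \<open>
  The leading car \<open>v\<close> is kept apart from the \<open>r\<close> cars that follow it, and it carries no factor
  \<open>y\<close> itself, so that the exponent counts a letter of the word \<open>ps\<close>.
\<close>
definition led_sum :: "'a::comm_ring_1 \<Rightarrow> nat \<Rightarrow> nat \<Rightarrow> nat \<Rightarrow> 'a" where
  "led_sum y N b r = (\<Sum>v\<in>{b<..N}. \<Sum>ps\<in>words r {b<..N}.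
     of_bool (fits N (v # ps)) * y ^ count_list ps v)"

definition level_led_sum :: "'a::comm_ring_1 \<Rightarrow> 'a \<Rightarrow> nat \<Rightarrow> nat \<Rightarrow> nat \<Rightarrow> nat \<Rightarrow> 'a" where
  "level_led_sum x y k N b r = (\<Sum>v\<in>{b<..N}. \<Sum>ps\<in>words r {b<..N}.
     of_bool (fits N (v # ps)) *
       (x ^ length (filter (\<lambda>p. p \<le> b + k) (v # ps)) * y ^ count_list ps v))"

text \<open>
  The shuffle decomposition for an initial block, with membership in the block replaced by a
  comparison, so that it composes with \<open>fits_filter_iff\<close>.
\<close>
lemma sum_words_split_block:
  fixes w :: "nat \<Rightarrow> 'a::comm_ring_1"
  assumes "b + k \<le> N"
  shows "(\<Sum>ps\<in>words r {b<..N}.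
           prod_list (map w (filter (\<lambda>p. p \<le> b + k) ps)) * f (filter (\<lambda>p. b + k < p) ps)) =
    (\<Sum>c\<le>r. of_nat (r choose c) * sum w {b<..b + k} ^ c *
       (\<Sum>ps\<in>words (r - c) {b + k<..N}. f ps))"
proof -
  have un: "{b<..N} = {b<..b + k} \<union> {b + k<..N}" using assms by auto
  have "(\<Sum>ps\<in>words r {b<..N}.
           prod_list (map w (filter (\<lambda>p. p \<le> b + k) ps)) * f (filter (\<lambda>p. b + k < p) ps)) =
    (\<Sum>ps\<in>words r ({b<..b + k} \<union> {b + k<..N}).
           prod_list (map w (filter (\<lambda>p. p \<in> {b<..b + k}) ps)) * f (filter (\<lambda>p. p \<in> {b + k<..N}) ps))"
    unfolding un
  proof (rule sum.cong[OF refl])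
    fix ps assume "ps \<in> words r ({b<..b + k} \<union> {b + k<..N})"
    then have s: "set ps \<subseteq> {b<..b + k} \<union> {b + k<..N}" by (simp add: words_def)
    have "filter (\<lambda>p. p \<le> b + k) ps = filter (\<lambda>p. p \<in> {b<..b + k}) ps"
      "filter (\<lambda>p. b + k < p) ps = filter (\<lambda>p. p \<in> {b + k<..N}) ps"
      using s by (auto intro!: filter_cong)
    then show "prod_list (map w (filter (\<lambda>p. p \<le> b + k) ps)) * f (filter (\<lambda>p. b + k < p) ps) =
       prod_list (map w (filter (\<lambda>p. p \<in> {b<..b + k}) ps)) * f (filter (\<lambda>p. p \<in> {b + k<..N}) ps)"
      by simp
  qed
  also have "\<dots> = (\<Sum>c\<le>r. of_nat (r choose c) * sum w {b<..b + k} ^ c *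
       (\<Sum>ps\<in>words (r - c) {b + k<..N}. f ps))"
    by (rule sum_words_Un) auto
  finally show ?thesis .
qed

lemma fit_count_rec:
  assumes "r + b \<le> N" "b < N"
  shows "(fit_count N b r :: 'a::comm_ring_1) =
    (\<Sum>c\<le>r. of_nat (r choose c) * fit_count N (Suc b) (r - c))"
proof -
  have "(fit_count N b r :: 'a) = (\<Sum>ps\<in>words r {b<..N}.
     prod_list (map (\<lambda>_. 1) (filter (\<lambda>p. p \<le> b + 1) ps)) * of_bool (fits N (filter (\<lambda>p. b + 1 < p) ps)))"
    unfolding fit_count_def
  proof (rule sum.cong[OF refl])
    fix ps assume "ps \<in> words r {b<..N}"
    then have "fits N ps = fits N (filter (\<lambda>p. b + 1 < p) ps)"
      using assms by (intro fits_filter_iff) (simp add: words_def)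
    then show "(of_bool (fits N ps) :: 'a) = prod_list (map (\<lambda>_. 1) (filter (\<lambda>p. p \<le> b + 1) ps)) *
        of_bool (fits N (filter (\<lambda>p. b + 1 < p) ps))"
      by (simp add: map_replicate_const)
  qed
  also have "\<dots> = (\<Sum>c\<le>r. of_nat (r choose c) * fit_count N (Suc b) (r - c))"
    using assms by (subst sum_words_split_block) (simp_all add: fit_count_def)
  finally show ?thesis .
qed

text \<open>
  The first sum collects the words whose leading car prefers a spot \<open>v\<close> of the block: a later car
  in the block weighs \<open>x y\<close> if it prefers \<open>v\<close> too and \<open>x\<close> otherwise, and the cars outside of
  the block are unmarked. In the second sum the leading car lies beyond the block, so every car in
  the block weighs \<open>x\<close> and the leading car stays in front of the cars outside of it. Since the leading
  car is not counted by \<open>r\<close>, the hypothesis of \<open>fits_filter_iff\<close> becomes \<open>r + b + k \<le> N\<close>.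
\<close>
lemma level_led_sum_rec:
  fixes x y :: "'a::comm_ring_1"
  assumes "r + b + k \<le> N" "0 < k"
  shows "level_led_sum x y k N b r =
    of_nat k * x *
      (\<Sum>c\<le>r. of_nat (r choose c) * (x * y + of_nat (k - 1) * x) ^ c * fit_count N (b + k) (r - c)) +
    (\<Sum>c\<le>r. of_nat (r choose c) * (of_nat k * x) ^ c * led_sum y N (b + k) (r - c))"
proof -
  let ?t = "\<lambda>v ps. of_bool (fits N (v # ps)) *
       (x ^ length (filter (\<lambda>p. p \<le> b + k) (v # ps)) * y ^ count_list ps v)"
  have un: "{b<..N} = {b<..b + k} \<union> {b + k<..N}" using assms by auto
  have fits_rest: "fits N (v # ps) = fits N (filter (\<lambda>p. b + k < p) (v # ps))"
    if "ps \<in> words r {b<..N}" for v ps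
    using that assms by (intro fits_filter_iff) (simp add: words_def)
  have low: "(\<Sum>ps\<in>words r {b<..N}. ?t v ps) =
      x * (\<Sum>c\<le>r. of_nat (r choose c) * (x * y + of_nat (k - 1) * x) ^ c * fit_count N (b + k) (r - c))"
    if v: "v \<in> {b<..b + k}" for v
  proof -
    define w where "w = (\<lambda>p. x * (if p = v then y else 1))"
    have w: "prod_list (map w (filter (\<lambda>p. p \<le> b + k) ps)) =
        x ^ length (filter (\<lambda>p. p \<le> b + k) ps) * y ^ count_list ps v" for ps
      using v by (induction ps) (auto simp: w_def)
    have "sum w {b<..b + k} = w v + sum w ({b<..b + k} - {v})"
      using v by (intro sum.remove) auto
    also have "sum w ({b<..b + k} - {v}) = (\<Sum>p\<in>{b<..b + k} - {v}. x)"
      by (intro sum.cong) (auto simp: w_def)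
    finally have sw: "sum w {b<..b + k} = x * y + of_nat (k - 1) * x"
      using v by (simp add: w_def card_Diff_singleton)
    have "(\<Sum>ps\<in>words r {b<..N}. ?t v ps) = (\<Sum>ps\<in>words r {b<..N}.
       prod_list (map w (filter (\<lambda>p. p \<le> b + k) ps)) * (x * of_bool (fits N (filter (\<lambda>p. b + k < p) ps))))"
      using v by (intro sum.cong refl) (simp add: w fits_rest mult_ac)
    also have "\<dots> = (\<Sum>c\<le>r. of_nat (r choose c) * (x * y + of_nat (k - 1) * x) ^ c *
        (\<Sum>ps\<in>words (r - c) {b + k<..N}. x * of_bool (fits N ps)))"
      unfolding sw[symmetric] using assms
      by (intro sum_words_split_block[where f = "\<lambda>ps. x * of_bool (fits N ps)"]) simp
    finally show ?thesis
      by (simp add: fit_count_def sum_distrib_left mult_ac)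
  qed
  have high: "(\<Sum>ps\<in>words r {b<..N}. ?t v ps) =
      (\<Sum>c\<le>r. of_nat (r choose c) * (of_nat k * x) ^ c *
        (\<Sum>ps\<in>words (r - c) {b + k<..N}. of_bool (fits N (v # ps)) * y ^ count_list ps v))"
    if v: "v \<in> {b + k<..N}" for v
  proof -
    have cnt: "count_list (filter (\<lambda>p. b + k < p) ps) v = count_list ps v" for ps
      using v by (induction ps) auto
    have "(\<Sum>ps\<in>words r {b<..N}. ?t v ps) = (\<Sum>ps\<in>words r {b<..N}.
       prod_list (map (\<lambda>_. x) (filter (\<lambda>p. p \<le> b + k) ps)) *
         (\<lambda>ps. of_bool (fits N (v # ps)) * y ^ count_list ps v) (filter (\<lambda>p. b + k < p) ps))"
      using v by (intro sum.cong refl) (simp add: fits_rest cnt map_replicate_const mult_ac)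
    also have "\<dots> = (\<Sum>c\<le>r. of_nat (r choose c) * (\<Sum>p\<in>{b<..b + k}. x) ^ c *
        (\<Sum>ps\<in>words (r - c) {b + k<..N}. of_bool (fits N (v # ps)) * y ^ count_list ps v))"
      using assms by (intro sum_words_split_block) simp
    finally show ?thesis by simp
  qed
  have "level_led_sum x y k N b r =
      (\<Sum>v\<in>{b<..b + k}. \<Sum>ps\<in>words r {b<..N}. ?t v ps) +
      (\<Sum>v\<in>{b + k<..N}. \<Sum>ps\<in>words r {b<..N}. ?t v ps)"
    unfolding level_led_sum_def by (subst (1) un, rule sum.union_disjoint) auto
  also have "(\<Sum>v\<in>{b + k<..N}. \<Sum>ps\<in>words r {b<..N}. ?t v ps) =
      (\<Sum>c\<le>r. of_nat (r choose c) * (of_nat k * x) ^ c * led_sum y N (b + k) (r - c))"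
    unfolding led_sum_def sum_distrib_left[where A = "{b + k<..N}"]
    by (subst sum.swap) (intro sum.cong refl high)
  also have "(\<Sum>v\<in>{b<..b + k}. \<Sum>ps\<in>words r {b<..N}. ?t v ps) = (\<Sum>v\<in>{b<..b + k}.
      x * (\<Sum>c\<le>r. of_nat (r choose c) * (x * y + of_nat (k - 1) * x) ^ c * fit_count N (b + k) (r - c)))"
    by (intro sum.cong refl low)
  also have "\<dots> = of_nat k * x *
      (\<Sum>c\<le>r. of_nat (r choose c) * (x * y + of_nat (k - 1) * x) ^ c * fit_count N (b + k) (r - c))"
    by (simp only: sum_constant card_greaterThanAtMost add_diff_cancel_left' mult.assoc)
  finally show ?thesis .
qed

text \<open>
  At \<open>x = 1\<close> the block leaves no trace in the weight; hence the recursion above with a block of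
  one spot becomes a recursion for \<open>led_sum\<close> itself.
\<close>
lemma level_led_sum_1: "level_led_sum 1 y k N b r = led_sum y N b r"
  by (simp add: level_led_sum_def led_sum_def)


section \<open>Closed forms\<close>

lemma sum_choose_power:
  fixes a z :: "'a::comm_ring_1"
  shows "(\<Sum>c\<le>r. of_nat (r choose c) * a ^ c * z ^ (r - c)) = (a + z) ^ r"
  by (simp add: binomial_ring)

text \<open>The derivative of the binomial theorem with respect to \<open>z\<close>.\<close>
lemma sum_choose_power_deriv:
  fixes a z :: "'a::comm_ring_1"
  shows "(\<Sum>c\<le>r. of_nat (r choose c) * a ^ c * (of_nat (r - c) * z ^ (r - c - 1))) =
    of_nat r * (a + z) ^ (r - 1)"
proof (cases r)
  case 0
  then show ?thesis by simp
next
  case (Suc s)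
  have "of_nat (Suc s choose c) * a ^ c * (of_nat (Suc s - c) * z ^ (Suc s - c - 1)) =
      of_nat (Suc s) * (of_nat (s choose c) * a ^ c * z ^ (s - c))" if "c \<le> s" for c
  proof -
    have "(Suc s choose c) * (Suc s - c) = Suc s * (s choose c)"
      using binomial_absorb_comp[of "Suc s" c] by (simp add: mult.commute)
    then have "of_nat (Suc s choose c) * of_nat (Suc s - c) = (of_nat (Suc s) * of_nat (s choose c) :: 'a)"
      by (metis of_nat_mult)
    moreover have "Suc s - c - 1 = s - c" by simp
    ultimately show ?thesis by (metis (no_types, opaque_lifting) mult.assoc mult.commute)
  qed
  then show ?thesis
    unfolding Suc sum.atMost_Suc
    by (simp add: sum_choose_power[symmetric] sum_distrib_left del: of_nat_Suc)
qed

text \<open>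
  This is \<open>(d + 1 - r) (d + 1)^(r - 1)\<close>, written as the difference of a power and its derivative:
  binomial sums preserve this shape, and it is correct at \<open>r = 0\<close>, where the exponent
  \<open>r - 1\<close> is truncated but has the factor \<open>0\<close>. The boundary case \<open>r = d + 1\<close>, where both
  sides vanish, is included because removing one spot while no car prefers it leads from
  \<open>r = d\<close> to that case.
\<close>
lemma fit_count_closed:
  "r \<le> d + 1 \<Longrightarrow> (fit_count (b + d) b r :: 'a::comm_ring_1) =
     of_nat (d + 1) ^ r - of_nat r * of_nat (d + 1) ^ (r - 1)"
proof (induction d arbitrary: b r)
  case 0
  then have "r = 0 \<or> r = Suc 0" by linarith
  then show ?case by (auto simp: fit_count_def fits_def sum_words_Suc simp del: sum_of_bool_eq)
next
  case (Suc d)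
  show ?case
  proof (cases "r \<le> Suc d")
    case True
    have "(fit_count (b + Suc d) b r :: 'a) =
        (\<Sum>c\<le>r. of_nat (r choose c) * fit_count (Suc b + d) (Suc b) (r - c))"
      using fit_count_rec[of r b "b + Suc d"] True by simp
    also have "\<dots> = (\<Sum>c\<le>r. of_nat (r choose c) * 1 ^ c * of_nat (d + 1) ^ (r - c)) -
        (\<Sum>c\<le>r. of_nat (r choose c) * 1 ^ c * (of_nat (r - c) * of_nat (d + 1) ^ (r - c - 1)))"
      unfolding sum_subtractf[symmetric]
      using True by (intro sum.cong refl, subst Suc.IH) (simp_all add: right_diff_distrib)
    finally show ?thesis
      unfolding sum_choose_power sum_choose_power_deriv by (simp add: add_ac)
  next
    case False
    then have r: "r = Suc (d + 1)" using Suc.prems by simp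
    have "(fit_count (b + Suc d) b r :: 'a) = 0"
      unfolding fit_count_def
      by (intro sum.neutral ballI) (use r in \<open>auto simp: words_def not_fits_if_too_long\<close>)
    then show ?thesis by (simp add: r)
  qed
qed

lemma sum_choose_fit_count:
  fixes a :: "'a::comm_ring_1"
  assumes "r \<le> d + 1"
  shows "(\<Sum>c\<le>r. of_nat (r choose c) * a ^ c * fit_count (b + d) b (r - c)) =
    (a + of_nat (d + 1)) ^ r - of_nat r * (a + of_nat (d + 1)) ^ (r - 1)"
proof -
  have "(\<Sum>c\<le>r. of_nat (r choose c) * a ^ c * fit_count (b + d) b (r - c)) =
      (\<Sum>c\<le>r. of_nat (r choose c) * a ^ c * of_nat (d + 1) ^ (r - c)) -
      (\<Sum>c\<le>r. of_nat (r choose c) * a ^ c * (of_nat (r - c) * of_nat (d + 1) ^ (r - c - 1)))"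
    unfolding sum_subtractf[symmetric]
    using assms by (intro sum.cong refl, subst fit_count_closed) (simp_all add: right_diff_distrib)
  then show ?thesis unfolding sum_choose_power sum_choose_power_deriv .
qed

text \<open>
  The binomial transform of the closed form \<open>(d - j) z^j\<close> for \<open>led_sum\<close>: the factor \<open>j\<close> is
  produced by the derivative.
\<close>
lemma sum_choose_led_closed:
  fixes a z :: "'a::comm_ring_1"
  shows "(\<Sum>c\<le>r. of_nat (r choose c) * a ^ c * ((of_nat d - of_nat (r - c)) * z ^ (r - c))) =
    of_nat d * (a + z) ^ r - of_nat r * z * (a + z) ^ (r - 1)"
proof -
  have z: "of_nat j * z ^ j = z * (of_nat j * z ^ (j - 1))" for j
    by (cases j) simp_all
  have "(\<Sum>c\<le>r. of_nat (r choose c) * a ^ c * ((of_nat d - of_nat (r - c)) * z ^ (r - c))) =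
      of_nat d * (\<Sum>c\<le>r. of_nat (r choose c) * a ^ c * z ^ (r - c)) -
      z * (\<Sum>c\<le>r. of_nat (r choose c) * a ^ c * (of_nat (r - c) * z ^ (r - c - 1)))"
    unfolding sum_subtractf[symmetric] sum_distrib_left left_diff_distrib z
    by (intro sum.cong refl) (simp add: algebra_simps)
  then show ?thesis
    unfolding sum_choose_power sum_choose_power_deriv by (simp add: mult_ac)
qed

text \<open>
  Removing one of \<open>d + 1\<close> spots expresses the sum as \<open>u^r - r u^(r - 1)\<close>, from words whose leading car prefers that spot, plus
  \<open>d u^r - r (u - 1) u^(r - 1)\<close>, from the others, where \<open>u = y + d + 1\<close>; the sum
  collapses to \<open>(d + 1 - r) u^r\<close>. If \<open>r\<close> equals the number of spots,
  there is one car too many and both sides are \<open>0\<close>.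
\<close>
lemma led_sum_closed:
  fixes y :: "'a::comm_ring_1"
  shows "r \<le> d \<Longrightarrow> led_sum y (b + d) b r = (of_nat d - of_nat r) * (y + of_nat d) ^ r"
proof (induction d arbitrary: b r)
  case 0
  then show ?case by (simp add: led_sum_def)
next
  case (Suc d)
  show ?case
  proof (cases "r = Suc d")
    case True
    have "\<not> fits (b + Suc d) (v # ps)"
      if "v \<in> {b<..b + Suc d}" "ps \<in> words r {b<..b + Suc d}" for v ps
      using that True by (intro not_fits_if_too_long[of _ b]) (auto simp: words_def)
    then have "led_sum y (b + Suc d) b r = 0"
      unfolding led_sum_def by (intro sum.neutral ballI) simp
    then show ?thesis using True by simp
  next
    case False
    then have r: "r \<le> d" using Suc.prems by simp
    let ?z = "y + of_nat d" and ?u = "y + of_nat (d + 1)"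
    have "led_sum y (b + Suc d) b r = level_led_sum 1 y 1 (b + Suc d) b r"
      by (simp add: level_led_sum_1)
    also have "\<dots> =
        (\<Sum>c\<le>r. of_nat (r choose c) * y ^ c * fit_count (Suc b + d) (Suc b) (r - c)) +
        (\<Sum>c\<le>r. of_nat (r choose c) * 1 ^ c * led_sum y (Suc b + d) (Suc b) (r - c))"
      using r by (subst level_led_sum_rec) simp_all
    also have "(\<Sum>c\<le>r. of_nat (r choose c) * y ^ c * fit_count (Suc b + d) (Suc b) (r - c)) =
        ?u ^ r - of_nat r * ?u ^ (r - 1)"
      using r by (intro sum_choose_fit_count) simp
    also have "(\<Sum>c\<le>r. of_nat (r choose c) * 1 ^ c * led_sum y (Suc b + d) (Suc b) (r - c)) =
        (\<Sum>c\<le>r. of_nat (r choose c) * 1 ^ c * ((of_nat d - of_nat (r - c)) * ?z ^ (r - c)))"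
      using r by (intro sum.cong refl, subst Suc.IH) simp_all
    also have "\<dots> = of_nat d * (1 + ?z) ^ r - of_nat r * ?z * (1 + ?z) ^ (r - 1)"
      by (rule sum_choose_led_closed)
    also have "1 + ?z = ?u" by simp
    finally show ?thesis
      by (cases r) (simp_all add: algebra_simps)
  qed
qed

text \<open>
  The case of \<open>r + 1\<close> cars and \<open>k + r\<close> spots, where the block of \<open>k\<close> spots is the level set
  and exactly \<open>r\<close> spots remain after its removal. In the closed form of \<open>led_sum\<close> the number of
  spots then cancels against the number of cars up to the \<open>c\<close> cars of the block, which is why the
  factor \<open>k x\<close> splits off from the last summand.
\<close>
lemma level_led_sum_closed:
  fixes x y :: "'a::comm_ring_1"
  assumes "0 < k"
  shows "level_led_sum x y k (b + k + r) b r =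
    of_nat k * x * ((x * y + of_nat (k - 1) * x + of_nat (r + 1)) ^ r
      - of_nat r * (x * y + of_nat (k - 1) * x + of_nat (r + 1)) ^ (r - 1)) +
    of_nat k * x * of_nat r * (of_nat k * x + y + of_nat r) ^ (r - 1)"
proof -
  let ?a = "of_nat k * x" and ?z = "y + of_nat r"
  have "(\<Sum>c\<le>r. of_nat (r choose c) * ?a ^ c * led_sum y (b + k + r) (b + k) (r - c)) =
      (\<Sum>c\<le>r. of_nat (r choose c) * ?a ^ c * ((of_nat r - of_nat (r - c)) * ?z ^ (r - c)))"
    by (intro sum.cong refl, subst led_sum_closed) simp_all
  also have "\<dots> = of_nat r * (?a + ?z) ^ r - of_nat r * ?z * (?a + ?z) ^ (r - 1)"
    by (rule sum_choose_led_closed)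
  also have "\<dots> = ?a * of_nat r * (?a + y + of_nat r) ^ (r - 1)"
    by (cases r) (simp_all add: algebra_simps)
  finally show ?thesis
    using assms
      sum_choose_fit_count[of r r "x * y + of_nat (k - 1) * x" "b + k"]
    by (subst level_led_sum_rec) simp_all
qed


section \<open>The generating function of parking functions\<close>

lemma lel_Cons: "lel (v # ps) = Suc (count_list ps v)"
proof -
  have "lel (v # ps) = length (filter (\<lambda>p. p = v) (v # ps))"
    unfolding lel_def length_filter_conv_card by simp
  also have "length (filter (\<lambda>p. p = v) ps) = count_list ps v" for ps
    by (induction ps) auto
  finally show ?thesis by simp
qed

lemma slev_eq_length_filter:
  assumes "set ps \<subseteq> {0<..n}"
  shows "slev m n ps = length (filter (\<lambda>p. p \<le> n - m + 1) ps)"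
proof -
  have "slev m n ps = length (filter (\<lambda>p. p \<in> {1..n - m + 1}) ps)"
    unfolding slev_def length_filter_conv_card by simp
  also have "filter (\<lambda>p. p \<in> {1..n - m + 1}) ps = filter (\<lambda>p. p \<le> n - m + 1) ps"
    using assms by (auto intro!: filter_cong)
  finally show ?thesis .
qed

lemma sum_PF_eq_level_led_sum:
  fixes x y :: "'a::comm_ring_1"
  assumes "1 \<le> m"
  shows "(\<Sum>p\<in>PF m n. x ^ slev m n p * y ^ lel p) =
    y * level_led_sum x y (n - m + 1) n 0 (m - 1)"
proof -
  let ?g = "\<lambda>p. x ^ slev m n p * y ^ lel p"
  have m: "m = Suc (m - 1)" using assms by simp
  have "PF m n = words m {0<..n} \<inter> Collect (fits n)" by (auto simp: PF_eq_fits words_def)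
  then have "sum ?g (PF m n) = (\<Sum>p\<in>words m {0<..n}. of_bool (fits n p) * ?g p)"
    by (simp add: sum.inter_filter[symmetric] of_bool_def if_distrib[of "\<lambda>b. b * _"] Int_def cong: if_cong)
  also have "\<dots> = (\<Sum>v\<in>{0<..n}. \<Sum>ps\<in>words (m - 1) {0<..n}. of_bool (fits n (v # ps)) * ?g (v # ps))"
    by (subst (1) m) (rule sum_words_Suc)
  also have "\<dots> = y * level_led_sum x y (n - m + 1) n 0 (m - 1)"
    unfolding level_led_sum_def sum_distrib_left
  proof (intro sum.cong refl)
    fix v ps assume "v \<in> {0<..n}" "ps \<in> words (m - 1) {0<..n}"
    then have "set (v # ps) \<subseteq> {0<..n}" by (auto simp: words_def)
    from slev_eq_length_filter[OF this]
    show "of_bool (fits n (v # ps)) * ?g (v # ps) = y * (of_bool (fits n (v # ps)) *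
       (x ^ length (filter (\<lambda>p. p \<le> 0 + (n - m + 1)) (v # ps)) * y ^ count_list ps v))"
      by (simp add: lel_Cons mult_ac)
  qed
  finally show ?thesis .
qed

text \<open>
  For \<open>m = 1\<close> the base of the negative power must cancel against the factor in front of it. It is
  not \<open>0\<close>, as it is a polynomial with constant coefficient \<open>1\<close>.
\<close>
lemma base_neq_0: "X * Y + of_nat k * X + 1 \<noteq> 0"
proof -
  have "X * Y + of_nat k * X + 1 = Fract [:[:1, of_nat k:], [:0, 1:]:] 1"
    by (simp add: X_def Y_def One_fract_def of_nat_fract of_nat_poly one_pCons)
  also have "\<dots> \<noteq> 0" by (simp add: Zero_fract_def eq_fract)
  finally show ?thesis .
qed

theorem corollary2p5:
  fixes m n :: nat
  assumes "1 \<le> m" and "m \<le> n"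
  shows "(\<Sum>p\<in>PF m n. X ^ slev m n p * Y ^ lel p) =
    of_nat (n - m + 1) * X * Y *
      (of_nat (m - 1) * (of_nat (n - m + 1) * X + Y + of_nat (m - 1)) powi (int m - 2)
       + (X * Y + of_nat (n - m) * X + 1) * (X * Y + of_nat (n - m) * X + of_nat m) powi (int m - 2))"
proof -
  define k where "k = n - m + 1"
  define r where "r = m - 1"
  define w where "w = X * Y + of_nat (n - m) * X"
  have k: "0 < k" "k - 1 = n - m" and n: "n = 0 + k + r" and m: "m = r + 1"
    using assms by (auto simp: k_def r_def)
  have sum: "(\<Sum>p\<in>PF m n. X ^ slev m n p * Y ^ lel p) =
      of_nat k * X * Y * ((w + of_nat m) ^ r - of_nat r * (w + of_nat m) ^ (r - 1) +
        of_nat r * (of_nat k * X + Y + of_nat r) ^ (r - 1))"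
    using sum_PF_eq_level_led_sum[OF assms(1), of X n Y]
      level_led_sum_closed[OF k(1), of X Y 0 r]
    unfolding k_def[symmetric] r_def[symmetric] n[symmetric] m[symmetric] k(2) w_def[symmetric]
    by (simp add: algebra_simps)
  show ?thesis
  proof (cases r)
    case 0
    then have "(w + 1) * (w + of_nat m) powi (int m - 2) = 1"
      using base_neq_0[of "n - m"] m by (simp add: w_def power_int_minus)
    then show ?thesis
      using sum 0 unfolding k_def[symmetric] r_def[symmetric] w_def[symmetric] by simp
  next
    case (Suc s)
    then have "int m - 2 = int s" using m by simp
    moreover have "(w + of_nat m) ^ r - of_nat r * (w + of_nat m) ^ (r - 1) = (w + 1) * (w + of_nat m) ^ s"
      using Suc m by (simp add: algebra_simps)
    ultimately show ?thesis
      using sum Suc unfolding k_def[symmetric] r_def[symmetric] w_def[symmetric]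
      by (simp add: add.commute)
  qed
qed

end
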